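(* Let $G=(V,E)$ be a finite graph. Then $G$ does not contain a bipartite connected component if and only if for any vertex weight function $w_V\colon V\to\mathbb{R}$ there exists an edge weight function $w_E\colon E\to\mathbb{R}$ such that the weight of any vertex is equal to the sum of the weights of the edges incident to this vertex, i.e. for every $v\in V$ $$w_V(v)=\sum_{e\in E\colon v\in e} w_E(e).$$
   Context: Graphs are finite, undirected and without loops; multiple edges are allowed. An isolated vertex is a connected component, and it is bipartite (one of its parts being empty). *)

theory Defs
  imports Complex_Main
begin

text \<open>
  Edges are abstract objects with an end-set map \<open>ends\<close>, so distinct edges may have the same
  pair of ends (multiple edges); requiring two distinct ends excludes loops.
\<close>

locale finite_multigraph =
  fixes V :: "'v set" and E :: "'e set" and ends :: "'e \<Rightarrow> 'v set"
  assumes finite_verts: "finite V"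
    and finite_edges: "finite E"
    and ends_subset: "e \<in> E \<Longrightarrow> ends e \<subseteq> V"
    and card_ends: "e \<in> E \<Longrightarrow> card (ends e) = 2"

definition adjacency :: "'e set \<Rightarrow> ('e \<Rightarrow> 'v set) \<Rightarrow> 'v rel" where
  "adjacency E ends = {(u, v). \<exists>e\<in>E. ends e = {u, v}}"

definition connectedness :: "'v set \<Rightarrow> 'e set \<Rightarrow> ('e \<Rightarrow> 'v set) \<Rightarrow> 'v rel" where
  "connectedness V E ends = {(u, v). u \<in> V \<and> v \<in> V \<and> (u, v) \<in> (adjacency E ends)\<^sup>*}"

text \<open>
  A connected component is given by its vertex set; as a graph it is the subgraph induced on
  that set. In particular components are nonempty, and an isolated vertex \<open>v\<close> yields \<open>{v}\<close>.
\<close>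

definition components :: "'v set \<Rightarrow> 'e set \<Rightarrow> ('e \<Rightarrow> 'v set) \<Rightarrow> 'v set set" where
  "components V E ends = V // connectedness V E ends"

definition induced_edges :: "'e set \<Rightarrow> ('e \<Rightarrow> 'v set) \<Rightarrow> 'v set \<Rightarrow> 'e set" where
  "induced_edges E ends C = {e \<in> E. ends e \<subseteq> C}"

text \<open>The parts \<open>A\<close> and \<open>B\<close> may be empty.\<close>

definition bipartite :: "'v set \<Rightarrow> 'e set \<Rightarrow> ('e \<Rightarrow> 'v set) \<Rightarrow> bool" where
  "bipartite V E ends \<longleftrightarrow>
     (\<exists>A B. A \<union> B = V \<and> A \<inter> B = {} \<and> (\<forall>e\<in>E. \<exists>a\<in>A. \<exists>b\<in>B. ends e = {a, b}))"

end

theory Submission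
  imports Defs
begin

text \<open>
  Call a vertex weighting realizable if it arises from some edge weighting by summing over incident
  edges. The realizable weightings form a linear space, so every weighting is realizable exactly
  when every point mass \<open>\<delta>\<^sub>u\<close> is.

  Fix \<open>u\<close> and let \<open>C\<close> be its component. Weight \<open>1\<close> on a single edge \<open>{x, y}\<close> realizes
  \<open>\<delta>\<^sub>x + \<delta>\<^sub>y\<close>. Hence, for a neighbour \<open>y\<close> of \<open>x\<close>, adding it to \<open>\<delta>\<^sub>u - \<delta>\<^sub>x\<close> gives
  \<open>\<delta>\<^sub>u + \<delta>\<^sub>y\<close>, and subtracting it from \<open>\<delta>\<^sub>u + \<delta>\<^sub>x\<close> gives \<open>\<delta>\<^sub>u - \<delta>\<^sub>y\<close>. Starting from
  \<open>\<delta>\<^sub>u - \<delta>\<^sub>u = 0\<close>, it follows that every \<open>x \<in> C\<close> has at least one of \<open>\<delta>\<^sub>u - \<delta>\<^sub>x\<close> and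
  \<open>\<delta>\<^sub>u + \<delta>\<^sub>x\<close> realizable. If some \<open>x\<close> has both, their sum \<open>2 \<delta>\<^sub>u\<close> is realizable, and so is \<open>\<delta>\<^sub>u\<close>. If no
  \<open>x\<close> has both, then the two cases split \<open>C\<close> into two parts, every edge joins one part to the
  other, and \<open>C\<close> is bipartite (lemma \<open>point_mass_realizable_or_bipartite\<close>).

  Conversely, in a bipartite component each edge has one end in either part, so a realizable
  weighting has the same total on both parts, namely the total weight of the edges of the component
  (lemma \<open>sum_incident_weight_transversal\<close>). A point mass inside the component violates this.
\<close>

definition (in finite_multigraph) incident_weight :: "('e \<Rightarrow> real) \<Rightarrow> 'v \<Rightarrow> real" where
  "incident_weight w v = (\<Sum>e\<in>{e \<in> E. v \<in> ends e}. w e)"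

definition (in finite_multigraph) realizable :: "('v \<Rightarrow> real) \<Rightarrow> bool" where
  "realizable f \<longleftrightarrow> (\<exists>w. \<forall>v\<in>V. f v = incident_weight w v)"

definition point_mass :: "'v \<Rightarrow> 'v \<Rightarrow> real" where
  "point_mass u v = of_bool (v = u)"

context finite_multigraph
begin

lemma realizable_0: "realizable (\<lambda>v. 0)"
  unfolding realizable_def incident_weight_def by (rule exI[of _ "\<lambda>e. 0"]) simp

lemma realizable_add:
  assumes "realizable f" "realizable g"
  shows "realizable (\<lambda>v. f v + g v)"
proof -
  obtain w w' where "\<forall>v\<in>V. f v = incident_weight w v" "\<forall>v\<in>V. g v = incident_weight w' v"
    using assms unfolding realizable_def by blast
  then have "\<forall>v\<in>V. f v + g v = incident_weight (\<lambda>e. w e + w' e) v"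
    by (simp add: incident_weight_def sum.distrib)
  then show ?thesis unfolding realizable_def by blast
qed

lemma realizable_scale:
  assumes "realizable f"
  shows "realizable (\<lambda>v. c * f v)"
proof -
  obtain w where "\<forall>v\<in>V. f v = incident_weight w v"
    using assms unfolding realizable_def by blast
  then have "\<forall>v\<in>V. c * f v = incident_weight (\<lambda>e. c * w e) v"
    by (simp add: incident_weight_def sum_distrib_left)
  then show ?thesis unfolding realizable_def by blast
qed

lemma realizable_diff:
  assumes "realizable f" "realizable g"
  shows "realizable (\<lambda>v. f v - g v)"
  using realizable_add[OF assms(1) realizable_scale[OF assms(2), of "-1"]] by simp

lemma realizable_sum:
  assumes "finite S" "\<And>u. u \<in> S \<Longrightarrow> realizable (f u)"
  shows "realizable (\<lambda>v. \<Sum>u\<in>S. f u v)"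
  using assms by (induction S rule: finite_induct) (simp_all add: realizable_0 realizable_add)

lemma realizable_cong:
  assumes "\<And>v. v \<in> V \<Longrightarrow> f v = g v"
  shows "realizable f \<longleftrightarrow> realizable g"
  unfolding realizable_def using assms by simp

lemma realizable_edge:
  assumes "e \<in> E" "ends e = {x, y}"
  shows "realizable (\<lambda>v. point_mass x v + point_mass y v)"
proof -
  have "x \<noteq> y" using card_ends[OF assms(1)] assms(2) by auto
  have "point_mass x v + point_mass y v = incident_weight (\<lambda>e'. of_bool (e' = e)) v" for v
  proof -
    have "incident_weight (\<lambda>e'. of_bool (e' = e)) v = of_bool (v \<in> ends e)"
      using finite_edges assms(1) by (simp add: incident_weight_def of_bool_def)
    then show ?thesis using assms(2) \<open>x \<noteq> y\<close> by (auto simp: point_mass_def)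
  qed
  then show ?thesis unfolding realizable_def by blast
qed

lemma all_realizable_if_point_masses:
  assumes "\<And>u. u \<in> V \<Longrightarrow> realizable (point_mass u)"
  shows "realizable f"
proof -
  have "realizable (\<lambda>v. \<Sum>u\<in>V. f u * point_mass u v)"
    using assms by (intro realizable_sum realizable_scale finite_verts)
  moreover have "(\<Sum>u\<in>V. f u * point_mass u v) = f v" if "v \<in> V" for v
    using that finite_verts by (simp add: point_mass_def of_bool_def if_distrib cong: if_cong)
  ultimately show ?thesis
    using realizable_cong[of "\<lambda>v. \<Sum>u\<in>V. f u * point_mass u v" f] by blast
qed

lemma component_closed:
  assumes "C \<in> components V E ends" "e \<in> E" "x \<in> ends e" "x \<in> C"
  shows "ends e \<subseteq> C"
proof
  fix y assume "y \<in> ends e"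
  obtain u where u: "C = connectedness V E ends `` {u}"
    using assms(1) by (auto simp: components_def elim: quotientE)
  have "y \<in> V" using ends_subset assms(2) \<open>y \<in> ends e\<close> by blast
  obtain a b where "ends e = {a, b}"
    using card_ends[OF assms(2)] by (auto simp: card_2_iff)
  then have "x = y \<or> ends e = {x, y}"
    using assms(3) \<open>y \<in> ends e\<close> by auto
  then have "(x, y) \<in> (adjacency E ends)\<^sup>*"
    using assms(2) by (auto simp: adjacency_def)
  moreover have "u \<in> V" "(u, x) \<in> (adjacency E ends)\<^sup>*"
    using assms(4) by (auto simp: u connectedness_def)
  ultimately show "y \<in> C"
    using \<open>y \<in> V\<close> by (simp add: u connectedness_def)
qed

text \<open>
  A walk of even length from \<open>u\<close> to \<open>x\<close> makes the difference of the two point masses realizable, a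
  walk of odd length makes their sum realizable. Working with these two conditions instead of the
  parity of walks reduces the argument to a single step along an edge, which exchanges them.
\<close>

lemma realizable_step:
  assumes "e \<in> E" "ends e = {x, y}"
  shows "realizable (\<lambda>v. point_mass u v - point_mass x v) \<Longrightarrow>
      realizable (\<lambda>v. point_mass u v + point_mass y v)"
    and "realizable (\<lambda>v. point_mass u v + point_mass x v) \<Longrightarrow>
      realizable (\<lambda>v. point_mass u v - point_mass y v)"
  using realizable_add[OF _ realizable_edge[OF assms],
      of "\<lambda>v. point_mass u v - point_mass x v"]
    realizable_diff[OF _ realizable_edge[OF assms],
      of "\<lambda>v. point_mass u v + point_mass x v"]
  by simp_all

lemma realizable_connected:
  assumes "(u, x) \<in> (adjacency E ends)\<^sup>*"
  shows "realizable (\<lambda>v. point_mass u v - point_mass x v) \<or>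
    realizable (\<lambda>v. point_mass u v + point_mass x v)"
  using assms
proof (induction rule: rtrancl_induct)
  case base
  show ?case using realizable_0 by simp
next
  case (step x y)
  then obtain e where "e \<in> E" "ends e = {x, y}" by (auto simp: adjacency_def)
  then show ?case using step.IH realizable_step by blast
qed

text \<open>
  The two conditions serve as the two colours: a vertex that satisfies both makes \<open>point_mass u\<close>
  realizable, and otherwise they give a proper 2-colouring of the component.
\<close>

lemma point_mass_realizable_or_bipartite:
  fixes u
  defines "C \<equiv> connectedness V E ends `` {u}"
  shows "realizable (point_mass u) \<or> bipartite C (induced_edges E ends C) ends"
proof (rule disjCI)
  assume not_bip: "\<not> bipartite C (induced_edges E ends C) ends"
  define A where "A = {x \<in> C. realizable (\<lambda>v. point_mass u v - point_mass x v)}"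
  define B where "B = {x \<in> C. realizable (\<lambda>v. point_mass u v + point_mass x v)}"
  have cover: "A \<union> B = C"
    using realizable_connected by (auto simp: A_def B_def C_def connectedness_def)
  have crossing: "\<forall>e\<in>induced_edges E ends C. \<exists>a\<in>A. \<exists>b\<in>B. ends e = {a, b}"
  proof
    fix e assume "e \<in> induced_edges E ends C"
    then have e: "e \<in> E" "ends e \<subseteq> C" by (auto simp: induced_edges_def)
    obtain x y where xy: "ends e = {x, y}"
      using card_ends[OF e(1)] by (auto simp: card_2_iff)
    have "x \<in> A \<or> x \<in> B" using cover e xy by blast
    then show "\<exists>a\<in>A. \<exists>b\<in>B. ends e = {a, b}"
    proof
      assume "x \<in> A"
      then have "y \<in> B"
        using realizable_step(1)[OF e(1) xy] e xy by (auto simp: A_def B_def)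
      then show ?thesis using \<open>x \<in> A\<close> xy by blast
    next
      assume "x \<in> B"
      then have "y \<in> A"
        using realizable_step(2)[OF e(1) xy] e xy by (auto simp: A_def B_def)
      then show ?thesis using \<open>x \<in> B\<close> xy by blast
    qed
  qed
  have "A \<inter> B \<noteq> {}"
  proof
    assume "A \<inter> B = {}"
    then have "bipartite C (induced_edges E ends C) ends"
      unfolding bipartite_def using cover crossing by (intro exI[of _ A] exI[of _ B] conjI)
    then show False using not_bip by contradiction
  qed
  then obtain x where "realizable (\<lambda>v. point_mass u v - point_mass x v)"
    "realizable (\<lambda>v. point_mass u v + point_mass x v)"
    by (auto simp: A_def B_def)
  from realizable_scale[OF realizable_add[OF this], of "1/2"]
  show "realizable (point_mass u)" by simp
qed

text \<open>Double counting: every edge weight enters the left-hand side through its one end in \<open>S\<close>.\<close>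

lemma sum_incident_weight_transversal:
  assumes "S \<subseteq> V" "F \<subseteq> E"
    and incident: "\<And>v e. v \<in> S \<Longrightarrow> e \<in> E \<Longrightarrow> v \<in> ends e \<Longrightarrow> e \<in> F"
    and one_end: "\<And>e. e \<in> F \<Longrightarrow> card {v \<in> S. v \<in> ends e} = 1"
  shows "(\<Sum>v\<in>S. incident_weight w v) = (\<Sum>e\<in>F. w e)"
proof -
  have fin: "finite S" "finite F"
    using assms(1,2) finite_verts finite_edges finite_subset by blast+
  have "{e \<in> E. v \<in> ends e} = {e \<in> F. v \<in> ends e}" if "v \<in> S" for v
    using that incident assms(2) by blast
  then have "(\<Sum>v\<in>S. incident_weight w v) = (\<Sum>v\<in>S. \<Sum>e\<in>{e \<in> F. v \<in> ends e}. w e)"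
    by (simp add: incident_weight_def)
  also have "\<dots> = (\<Sum>e\<in>F. \<Sum>v\<in>{v \<in> S. v \<in> ends e}. w e)"
    using fin by (rule sum.swap_restrict)
  also have "\<dots> = (\<Sum>e\<in>F. w e)"
    using one_end by simp
  finally show ?thesis .
qed

lemma bipartite_component_not_realizable:
  assumes C: "C \<in> components V E ends" and bip: "bipartite C (induced_edges E ends C) ends"
  shows "\<exists>f. \<not> realizable f"
proof -
  obtain u where u: "u \<in> V" "C = connectedness V E ends `` {u}"
    using C by (auto simp: components_def elim: quotientE)
  then have "u \<in> C" "C \<subseteq> V" by (auto simp: connectedness_def)
  then have "finite C" using finite_verts finite_subset by blast
  obtain A B where AB: "A \<union> B = C" "A \<inter> B = {}"
    and ends_AB: "\<forall>e\<in>induced_edges E ends C. \<exists>a\<in>A. \<exists>b\<in>B. ends e = {a, b}"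
    using bip unfolding bipartite_def by blast
  have total: "(\<Sum>v\<in>S. incident_weight w v) = (\<Sum>e\<in>induced_edges E ends C. w e)"
    if S: "S = A \<or> S = B" for S w
  proof (rule sum_incident_weight_transversal)
    show "S \<subseteq> V" using S AB \<open>C \<subseteq> V\<close> by blast
    show "induced_edges E ends C \<subseteq> E" by (auto simp: induced_edges_def)
    show "e \<in> induced_edges E ends C" if "v \<in> S" "e \<in> E" "v \<in> ends e" for v e
      using component_closed[OF C that(2,3)] that S AB(1) by (auto simp: induced_edges_def)
    show "card {v \<in> S. v \<in> ends e} = 1" if e: "e \<in> induced_edges E ends C" for e
    proof -
      obtain a b where ab: "a \<in> A" "b \<in> B" "ends e = {a, b}"
        using ends_AB e by blast
      then have "{v \<in> A. v \<in> ends e} = {a}" "{v \<in> B. v \<in> ends e} = {b}"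
        using AB(2) by auto
      then show ?thesis using S by auto
    qed
  qed
  have "\<not> realizable (point_mass u)"
  proof
    assume "realizable (point_mass u)"
    then obtain w where w: "\<And>v. v \<in> V \<Longrightarrow> point_mass u v = incident_weight w v"
      unfolding realizable_def by blast
    have mass: "(\<Sum>v\<in>S. incident_weight w v) = of_bool (u \<in> S)" if "S = A \<or> S = B" for S
    proof -
      have "S \<subseteq> V" "finite S"
        using that AB(1) \<open>C \<subseteq> V\<close> \<open>finite C\<close> by auto
      then have "(\<Sum>v\<in>S. incident_weight w v) = (\<Sum>v\<in>S. point_mass u v)"
        using w by (intro sum.cong) auto
      also have "\<dots> = of_bool (u \<in> S)"
        using \<open>finite S\<close> by (simp add: point_mass_def of_bool_def)
      finally show ?thesis .
    qed
    have "of_bool (u \<in> A) = (of_bool (u \<in> B) :: real)"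
      using mass[of A] mass[of B] total[of A w] total[of B w] by simp
    then show False using \<open>u \<in> C\<close> AB by (auto simp: of_bool_def split: if_splits)
  qed
  then show ?thesis by blast
qed

end

theorem theorem1p4:
  fixes V :: "'v set" and E :: "'e set" and ends :: "'e \<Rightarrow> 'v set"
  assumes "finite_multigraph V E ends"
  shows "\<not> (\<exists>C \<in> components V E ends. bipartite C (induced_edges E ends C) ends) \<longleftrightarrow>
    (\<forall>w\<^sub>V :: 'v \<Rightarrow> real. \<exists>w\<^sub>E :: 'e \<Rightarrow> real.
       \<forall>v\<in>V. w\<^sub>V v = (\<Sum>e\<in>{e \<in> E. v \<in> ends e}. w\<^sub>E e))"
proof -
  interpret finite_multigraph V E ends by (fact assms)
  have "\<not> (\<exists>C \<in> components V E ends. bipartite C (induced_edges E ends C) ends) \<longleftrightarrow>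
    (\<forall>f. realizable f)"
  proof
    assume no_bip: "\<not> (\<exists>C \<in> components V E ends. bipartite C (induced_edges E ends C) ends)"
    have "realizable (point_mass u)" if "u \<in> V" for u
    proof -
      have "connectedness V E ends `` {u} \<in> components V E ends"
        using that unfolding components_def by (rule quotientI)
      then show ?thesis using no_bip point_mass_realizable_or_bipartite by blast
    qed
    then show "\<forall>f. realizable f" using all_realizable_if_point_masses by blast
  next
    assume "\<forall>f. realizable f"
    then show "\<not> (\<exists>C \<in> components V E ends. bipartite C (induced_edges E ends C) ends)"
      using bipartite_component_not_realizable by blast
  qed
  then show ?thesis unfolding realizable_def incident_weight_def .
qed

end
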